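(* Every randomized algorithm that, given an $n\times n$ matrix $M$, decides whether $M$ has a (non-strict) saddlepoint and returns its value, correctly with probability at least $5/6$ on every input, must query in expectation $\Omega(n^2)$ entries of $M$, for some $n\times n$ matrix $M$.
   Context: A saddlepoint of a matrix is an entry that is the maximum of its row and the minimum of its column (not necessarily strictly). The algorithm accesses the matrix only by querying (reading) entries. *)

theory Defs
  imports "HOL-Probability.Probability" "Jordan_Normal_Form.Matrix"
begin

definition saddlepoint :: "real mat \<Rightarrow> nat \<Rightarrow> nat \<Rightarrow> bool" where
  "saddlepoint A i j \<longleftrightarrow>
     i < dim_row A \<and> j < dim_col A \<and>
     (\<forall>j'<dim_col A. A $$ (i, j') \<le> A $$ (i, j)) \<and>
     (\<forall>i'<dim_row A. A $$ (i, j) \<le> A $$ (i', j))"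

text \<open>A deterministic query algorithm: the continuation of \<open>Query i j k\<close> depends on the value read
  at position \<open>(i, j)\<close>. Being a codatatype, it includes algorithms that do not terminate on some
  inputs. \<open>Answer None\<close> claims that there is no saddlepoint, \<open>Answer (Some v)\<close> that there is one,
  of value \<open>v\<close>.\<close>

codatatype det_alg = Answer "real option" | Query nat nat "real \<Rightarrow> det_alg"

inductive outputs :: "real mat \<Rightarrow> det_alg \<Rightarrow> real option \<Rightarrow> bool" for A where
  outputs_Answer: "outputs A (Answer r) r"
| outputs_Query: "outputs A (k (A $$ (i, j))) r \<Longrightarrow> outputs A (Query i j k) r"

text \<open>\<open>in_queried A t p\<close>: the run of \<open>t\<close> on input \<open>A\<close>, terminating or not, reads position \<open>p\<close>.\<close>

inductive in_queried :: "real mat \<Rightarrow> det_alg \<Rightarrow> nat \<times> nat \<Rightarrow> bool" for A where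
  in_queried_here: "in_queried A (Query i j k) (i, j)"
| in_queried_later: "in_queried A (k (A $$ (i, j))) p \<Longrightarrow> in_queried A (Query i j k) p"

definition queried :: "real mat \<Rightarrow> det_alg \<Rightarrow> (nat \<times> nat) set" where
  "queried A t = {p. in_queried A t p}"

text \<open>A randomized algorithm is a probability distribution on deterministic algorithms. The
  \<open>\<sigma>\<close>-algebra is arbitrary, subject to the set of positions read and the answer being random
  variables on every input.\<close>

definition randomized_alg :: "nat \<Rightarrow> det_alg measure \<Rightarrow> bool" where
  "randomized_alg n R \<longleftrightarrow>
     prob_space R \<and>
     (\<forall>A \<in> carrier_mat n n.
        (\<forall>t \<in> space R. queried A t \<subseteq> {..<n} \<times> {..<n}) \<and>
        queried A \<in> measurable R (count_space UNIV) \<and>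
        (\<forall>r. {t \<in> space R. outputs A t r} \<in> sets R))"

definition correct_answer :: "real mat \<Rightarrow> real option \<Rightarrow> bool" where
  "correct_answer A r \<longleftrightarrow>
     (case r of
        None \<Rightarrow> \<not> (\<exists>i j. saddlepoint A i j)
      | Some v \<Rightarrow> (\<exists>i j. saddlepoint A i j \<and> A $$ (i, j) = v))"

definition decides_saddlepoint :: "nat \<Rightarrow> real \<Rightarrow> det_alg measure \<Rightarrow> bool" where
  "decides_saddlepoint n p R \<longleftrightarrow>
     (\<forall>A \<in> carrier_mat n n.
        measure R {t \<in> space R. \<exists>r. outputs A t r \<and> correct_answer A r} \<ge> p)"

text \<open>Repeated reads of the same entry are counted once, so a lower bound on this quantity also
  bounds the expected number of read operations.\<close>

definition expected_queries :: "det_alg measure \<Rightarrow> real mat \<Rightarrow> real" where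
  "expected_queries R A = (\<integral>t. real (card (queried A t)) \<partial>R)"

end

theory Submission
  imports Defs
begin

text \<open>
  A 0/1 matrix has a saddlepoint iff it has a zero row or an all-one column. Take matrices with
  exactly one 1 per row and no all-one column, and compare such a matrix \<open>M\<^sub>j\<close>, whose 1 in row \<open>i\<close>
  is in column \<open>j\<close>, with the matrix \<open>B\<close> in which row \<open>i\<close> is zero. An algorithm of success
  probability \<open>p\<close> must tell them apart, so it reads \<open>(i, j)\<close> on input \<open>B\<close> with probability at least
  \<open>2p - 1\<close>; hence it reads both \<open>(i, j)\<close> and \<open>(i, j')\<close> on \<open>B\<close> with probability at least \<open>4p - 3\<close>.
  Whichever of the two is read first on \<open>B\<close> is also read when the other one is changed to 1. So
  \<open>P[M\<^sub>j reads (i, j')] + P[M\<^sub>j' reads (i, j)] \<ge> 4p - 3\<close>, and averaging over all columns \<open>j, j'\<close> and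
  all positions of the 1s in the other rows gives at least \<open>n(4p - 3)/2\<close> expected reads per row.
\<close>

lemma sum_sum_ge_if_swap_ge:
  fixes f :: "'a \<Rightarrow> 'a \<Rightarrow> real"
  assumes "\<And>x y. x \<in> S \<Longrightarrow> y \<in> S \<Longrightarrow> b \<le> f x y + f y x"
  shows "(real (card S))\<^sup>2 * b \<le> 2 * (\<Sum>x\<in>S. \<Sum>y\<in>S. f x y)"
proof -
  have "(real (card S))\<^sup>2 * b = (\<Sum>x\<in>S. \<Sum>y\<in>S. b)"
    by (simp add: power2_eq_square)
  also have "\<dots> \<le> (\<Sum>x\<in>S. \<Sum>y\<in>S. f x y + f y x)"
    using assms by (intro sum_mono)
  also have "\<dots> = (\<Sum>x\<in>S. \<Sum>y\<in>S. f x y) + (\<Sum>x\<in>S. \<Sum>y\<in>S. f y x)"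
    by (simp add: sum.distrib)
  also have "(\<Sum>x\<in>S. \<Sum>y\<in>S. f y x) = (\<Sum>x\<in>S. \<Sum>y\<in>S. f x y)"
    by (rule sum.swap)
  finally show ?thesis
    by simp
qed

lemma sum_PiE_resample:
  fixes g :: "('a \<Rightarrow> 'b) \<Rightarrow> 'c::semiring_1"
  assumes "i \<in> I"
  shows "(\<Sum>f\<in>PiE I J. \<Sum>y\<in>J i. g (f(i := y))) = of_nat (card (J i)) * (\<Sum>f\<in>PiE I J. g f)"
proof -
  let ?K = "PiE (I - {i}) J"
  have split: "(\<Sum>f\<in>PiE I J. h f) = (\<Sum>y\<in>J i. \<Sum>f\<in>?K. h (f(i := y)))"
    for h :: "('a \<Rightarrow> 'b) \<Rightarrow> 'c"
  proof -
    have "PiE I J = (\<lambda>(y, f). f(i := y)) ` (J i \<times> ?K)"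
      using PiE_insert_eq[of i "I - {i}" J] assms by (simp add: insert_absorb)
    moreover have "inj_on (\<lambda>(y, f). f(i := y)) (J i \<times> ?K)"
      by (intro inj_combinator) simp
    ultimately show ?thesis
      by (simp add: sum.reindex sum.cartesian_product case_prod_unfold)
  qed
  have "(\<Sum>f\<in>PiE I J. \<Sum>y\<in>J i. g (f(i := y))) =
      of_nat (card (J i)) * (\<Sum>f\<in>?K. \<Sum>y\<in>J i. g (f(i := y)))"
    by (simp add: split)
  also have "(\<Sum>f\<in>?K. \<Sum>y\<in>J i. g (f(i := y))) = (\<Sum>f\<in>PiE I J. g f)"
    unfolding split by (rule sum.swap)
  finally show ?thesis .
qed

lemma (in prob_space) prob_Int_ge:
  assumes "E \<in> events" "F \<in> events"
  shows "prob E + prob F - 1 \<le> prob (E \<inter> F)"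
  using measure_Un3[of E M F] assms prob_le_1[of "E \<union> F"] by (simp add: fmeasurable_eq_sets)

inductive_simps outputs_Answer_iff [simp]: "outputs A (Answer r) r'"
inductive_simps outputs_Query_iff [simp]: "outputs A (Query i j k) r"
inductive_simps in_queried_Query_iff: "in_queried A (Query i j k) x"

lemma queried_Query [simp]: "queried A (Query i j k) = insert (i, j) (queried A (k (A $$ (i, j))))"
  by (auto simp: queried_def in_queried_Query_iff)

lemma outputs_unique:
  assumes "outputs A t r" "outputs A t r'"
  shows "r = r'"
  using assms by induction auto

lemma outputs_cong_queried:
  assumes "outputs B t r" "\<And>x. x \<in> queried B t \<Longrightarrow> A $$ x = B $$ x"
  shows "outputs A t r"
  using assms by induction auto

lemma queried_perturb_disj:
  assumes "x \<in> queried B t" "y \<in> queried B t"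
    and "\<And>z. z \<in> queried B t - {x} \<Longrightarrow> A $$ z = B $$ z"
    and "\<And>z. z \<in> queried B t - {y} \<Longrightarrow> A' $$ z = B $$ z"
  shows "y \<in> queried A t \<or> x \<in> queried A' t"
proof -
  have "in_queried B t x"
    using assms(1) by (simp add: queried_def)
  then show ?thesis
    using assms(2-)
  proof induction
    case (in_queried_later k i j x)
    show ?case
    proof (cases "(i, j) = x \<or> (i, j) = y")
      case False
      then have "A $$ (i, j) = B $$ (i, j)" "A' $$ (i, j) = B $$ (i, j)"
        using in_queried_later.prems(2,3) by auto
      then show ?thesis
        using in_queried_later False by auto
    qed auto
  qed simp
qed

definition sensitive_at :: "real mat \<Rightarrow> real mat \<Rightarrow> nat \<times> nat \<Rightarrow> bool" where
  "sensitive_at A B x \<longleftrightarrow>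
     (\<forall>y \<in> {..<dim_row B} \<times> {..<dim_col B} - {x}. A $$ y = B $$ y) \<and>
     \<not> (\<exists>r. correct_answer A r \<and> correct_answer B r)"

lemma finite_correct_answer: "finite {r. correct_answer A r}"
proof (rule finite_subset)
  show "{r. correct_answer A r} \<subseteq>
      insert None ((\<lambda>x. Some (A $$ x)) ` ({..<dim_row A} \<times> {..<dim_col A}))"
    by (force simp: correct_answer_def saddlepoint_def split: option.splits)
qed simp

locale randomized_query_alg =
  fixes n :: nat and R :: "det_alg measure"
  assumes randomized_alg: "randomized_alg n R"

sublocale randomized_query_alg \<subseteq> prob_space R
  using randomized_alg by (simp add: randomized_alg_def)

context randomized_query_alg
begin

definition query_prob :: "real mat \<Rightarrow> nat \<times> nat \<Rightarrow> real" where
  "query_prob A x = prob {t \<in> space R. x \<in> queried A t}"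

definition success_event :: "real mat \<Rightarrow> det_alg set" where
  "success_event A = {t \<in> space R. \<exists>r. outputs A t r \<and> correct_answer A r}"

lemma query_prob_nonneg: "0 \<le> query_prob A x"
  by (simp add: query_prob_def)

lemma queried_subset:
  assumes "A \<in> carrier_mat n n" "t \<in> space R"
  shows "queried A t \<subseteq> {..<n} \<times> {..<n}"
  using randomized_alg assms by (simp add: randomized_alg_def)

lemma queried_event:
  assumes "A \<in> carrier_mat n n"
  shows "{t \<in> space R. x \<in> queried A t} \<in> events"
proof -
  have "queried A \<in> measurable R (count_space UNIV)"
    using randomized_alg assms by (simp add: randomized_alg_def)
  from measurable_sets[OF this, of "{S. x \<in> S}"] show ?thesis
    by (simp add: vimage_def Int_def conj_commute)
qed

lemma success_event_sets:
  assumes "A \<in> carrier_mat n n"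
  shows "success_event A \<in> events"
proof -
  have "success_event A = (\<Union>r\<in>{r. correct_answer A r}. {t \<in> space R. outputs A t r})"
    by (auto simp: success_event_def)
  moreover have "{t \<in> space R. outputs A t r} \<in> events" for r
    using randomized_alg assms by (simp add: randomized_alg_def)
  ultimately show ?thesis
    using finite_correct_answer by auto
qed

lemma sensitive_at_queried:
  assumes "sensitive_at A B x" "B \<in> carrier_mat n n" "t \<in> success_event A" "t \<in> success_event B"
  shows "x \<in> queried B t"
proof (rule ccontr)
  assume unread: "x \<notin> queried B t"
  obtain r r' where r: "outputs A t r" "correct_answer A r"
    and r': "outputs B t r'" "correct_answer B r'" and t: "t \<in> space R"
    using assms(3,4) by (auto simp: success_event_def)
  have "A $$ y = B $$ y" if "y \<in> queried B t" for y
    using that unread queried_subset[OF assms(2) t] assms(1,2)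
    by (auto simp: sensitive_at_def)
  then have "outputs A t r'"
    by (rule outputs_cong_queried[OF r'(1)])
  then show False
    using outputs_unique[OF r(1)] r(2) r'(2) assms(1) by (auto simp: sensitive_at_def)
qed

lemma expected_queries_eq_sum:
  assumes "A \<in> carrier_mat n n"
  shows "expected_queries R A = (\<Sum>x\<in>{..<n} \<times> {..<n}. query_prob A x)"
proof -
  let ?E = "\<lambda>x. {t \<in> space R. x \<in> queried A t}"
  have "real (card (queried A t)) = (\<Sum>x\<in>{..<n} \<times> {..<n}. indicator (?E x) t)"
    if t: "t \<in> space R" for t
  proof -
    have "(\<Sum>x\<in>{..<n} \<times> {..<n}. indicator (?E x) t :: real) =
        (\<Sum>x\<in>{..<n} \<times> {..<n}. indicator (queried A t) x)"
      using t by (simp add: indicator_def)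
    also have "\<dots> = real (card (queried A t))"
      using queried_subset[OF assms t] by (simp add: indicator_def sum.If_cases Int_absorb1)
    finally show ?thesis
      by simp
  qed
  then have "expected_queries R A = (\<integral>t. (\<Sum>x\<in>{..<n} \<times> {..<n}. indicator (?E x) t) \<partial>R)"
    unfolding expected_queries_def by (intro Bochner_Integration.integral_cong) auto
  also have "\<dots> = (\<Sum>x\<in>{..<n} \<times> {..<n}. query_prob A x)"
    using queried_event[OF assms]
    by (subst Bochner_Integration.integral_sum)
      (auto simp: query_prob_def integrable_indicator_iff emeasure_eq_measure)
  finally show ?thesis .
qed

end

locale randomized_decider = randomized_query_alg +
  fixes p :: real
  assumes decides: "decides_saddlepoint n p R"
begin

lemma prob_success_event_ge:
  assumes "A \<in> carrier_mat n n"
  shows "p \<le> prob (success_event A)"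
  using decides assms by (simp add: decides_saddlepoint_def success_event_def)

lemma query_prob_sensitive_ge:
  assumes "A \<in> carrier_mat n n" "B \<in> carrier_mat n n" "sensitive_at A B x"
  shows "2 * p - 1 \<le> query_prob B x"
proof -
  have "2 * p - 1 \<le> prob (success_event A) + prob (success_event B) - 1"
    using prob_success_event_ge[OF assms(1)] prob_success_event_ge[OF assms(2)] by simp
  also have "\<dots> \<le> prob (success_event A \<inter> success_event B)"
    by (intro prob_Int_ge success_event_sets assms)
  also have "\<dots> \<le> query_prob B x"
    unfolding query_prob_def
  proof (intro finite_measure_mono queried_event assms subsetI)
    fix t assume t: "t \<in> success_event A \<inter> success_event B"
    then have "x \<in> queried B t"
      using assms sensitive_at_queried by blast
    with t show "t \<in> {t \<in> space R. x \<in> queried B t}"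
      by (simp add: success_event_def)
  qed
  finally show ?thesis .
qed

lemma query_prob_perturb_add_ge:
  assumes A: "A \<in> carrier_mat n n" "sensitive_at A B x"
    and A': "A' \<in> carrier_mat n n" "sensitive_at A' B y"
    and B: "B \<in> carrier_mat n n"
  shows "4 * p - 3 \<le> query_prob A y + query_prob A' x"
proof -
  let ?E = "\<lambda>A x. {t \<in> space R. x \<in> queried A t}"
  have "4 * p - 3 \<le> prob (?E B x) + prob (?E B y) - 1"
    using query_prob_sensitive_ge[OF A(1) B A(2)] query_prob_sensitive_ge[OF A'(1) B A'(2)]
    by (simp add: query_prob_def)
  also have "\<dots> \<le> prob (?E B x \<inter> ?E B y)"
    by (intro prob_Int_ge queried_event B)
  also have "\<dots> \<le> prob (?E A y \<union> ?E A' x)"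
  proof (intro finite_measure_mono sets.Un queried_event A A' subsetI)
    fix t assume t: "t \<in> ?E B x \<inter> ?E B y"
    then have "A $$ z = B $$ z" if "z \<in> queried B t - {x}" for z
      using that A(2) B queried_subset[OF B, of t] by (auto simp: sensitive_at_def)
    moreover have "A' $$ z = B $$ z" if "z \<in> queried B t - {y}" for z
      using t that A'(2) B queried_subset[OF B, of t] by (auto simp: sensitive_at_def)
    ultimately show "t \<in> ?E A y \<union> ?E A' x"
      using t queried_perturb_disj[of x B t y A A'] by auto
  qed
  also have "\<dots> \<le> query_prob A y + query_prob A' x"
    unfolding query_prob_def by (intro measure_Un_le queried_event A A')
  finally show ?thesis .
qed

end

text \<open>A value \<open>\<tau> i \<ge> n\<close> makes row \<open>i\<close> zero.\<close>

definition row_unit_mat :: "nat \<Rightarrow> (nat \<Rightarrow> nat) \<Rightarrow> real mat" where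
  "row_unit_mat n \<tau> = mat n n (\<lambda>(i, j). if j = \<tau> i then 1 else 0)"

lemma row_unit_mat_carrier [simp]: "row_unit_mat n \<tau> \<in> carrier_mat n n"
  and row_unit_mat_dim [simp]: "dim_row (row_unit_mat n \<tau>) = n" "dim_col (row_unit_mat n \<tau>) = n"
  and row_unit_mat_index [simp]:
    "i < n \<Longrightarrow> j < n \<Longrightarrow> row_unit_mat n \<tau> $$ (i, j) = (if j = \<tau> i then 1 else 0)"
  by (auto simp: row_unit_mat_def)

lemma row_unit_mat_no_saddlepoint:
  assumes \<tau>: "\<And>m. m < n \<Longrightarrow> \<tau> m < n" and "k < n" "l < n" "\<tau> k \<noteq> \<tau> l"
  shows "\<not> saddlepoint (row_unit_mat n \<tau>) i j"
proof
  assume saddle: "saddlepoint (row_unit_mat n \<tau>) i j"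
  then have i: "i < n" and j: "j < n"
    by (auto simp: saddlepoint_def)
  have "row_unit_mat n \<tau> $$ (i, \<tau> i) \<le> row_unit_mat n \<tau> $$ (i, j)"
    using saddle \<tau>[OF i] by (simp add: saddlepoint_def del: row_unit_mat_index)
  then have one: "row_unit_mat n \<tau> $$ (i, j) = 1"
    using i j \<tau>[OF i] by (simp split: if_splits)
  have "j = \<tau> m" if "m < n" for m
  proof -
    have "row_unit_mat n \<tau> $$ (i, j) \<le> row_unit_mat n \<tau> $$ (m, j)"
      using saddle that by (simp add: saddlepoint_def del: row_unit_mat_index)
    then show ?thesis
      unfolding one using that j by (simp split: if_splits)
  qed
  then show False
    using assms(2-4) by metis
qed

lemma row_unit_mat_saddlepoint:
  assumes "i < n" "n \<le> \<tau> i"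
  shows "saddlepoint (row_unit_mat n \<tau>) i 0"
  using assms by (auto simp: saddlepoint_def)

lemma sensitive_at_row_unit_mat:
  assumes "\<And>m. m < n \<Longrightarrow> \<tau> m < n" "k < n" "l < n" "\<tau> k \<noteq> \<tau> l"
    and "i < n" "i \<noteq> k" "i \<noteq> l" "j < n"
  shows "sensitive_at (row_unit_mat n (\<tau>(i := j))) (row_unit_mat n (\<tau>(i := n))) (i, j)"
proof -
  have "\<not> saddlepoint (row_unit_mat n (\<tau>(i := j))) a b" for a b
    using assms by (intro row_unit_mat_no_saddlepoint[of n _ k l]) auto
  moreover have "saddlepoint (row_unit_mat n (\<tau>(i := n))) i 0"
    using assms by (intro row_unit_mat_saddlepoint) auto
  ultimately have "\<not> (\<exists>r. correct_answer (row_unit_mat n (\<tau>(i := j))) r \<and>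
      correct_answer (row_unit_mat n (\<tau>(i := n))) r)"
    by (auto simp: correct_answer_def split: option.splits)
  then show ?thesis
    unfolding sensitive_at_def by (auto split: if_splits)
qed

text \<open>Fixing rows 0 and 1 rules out an all-one column.\<close>

definition allowed_cols :: "nat \<Rightarrow> nat \<Rightarrow> nat set" where
  "allowed_cols n i = (if i = 0 then {0} else if i = 1 then {1} else {..<n})"

definition col_choices :: "nat \<Rightarrow> (nat \<Rightarrow> nat) set" where
  "col_choices n = PiE {..<n} (allowed_cols n)"

lemma finite_col_choices: "finite (col_choices n)"
  unfolding col_choices_def by (intro finite_PiE) (auto simp: allowed_cols_def)

lemma col_choices_nonempty:
  assumes "2 \<le> n"
  shows "col_choices n \<noteq> {}"
  using assms by (auto simp: col_choices_def allowed_cols_def PiE_eq_empty_iff)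

lemma col_choicesD:
  assumes "\<tau> \<in> col_choices n" "2 \<le> n"
  shows "\<tau> 0 = 0" "\<tau> 1 = 1" "k < n \<Longrightarrow> \<tau> k < n"
proof -
  have mem: "\<tau> m \<in> allowed_cols n m" if "m < n" for m
    using assms(1) that by (simp add: col_choices_def PiE_iff)
  show "\<tau> 0 = 0" "\<tau> 1 = 1" "k < n \<Longrightarrow> \<tau> k < n"
    using mem[of 0] mem[of 1] mem[of k] assms(2)
    by (auto simp: allowed_cols_def split: if_splits)
qed

context randomized_decider
begin

lemma sum_query_prob_resampled_row_ge:
  assumes "\<tau> \<in> col_choices n" "i \<in> {2..<n}"
  shows "(real n)\<^sup>2 * (4 * p - 3) \<le>
    2 * (\<Sum>j<n. \<Sum>j'<n. query_prob (row_unit_mat n (\<tau>(i := j))) (i, j'))"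
proof -
  let ?M = "\<lambda>j. row_unit_mat n (\<tau>(i := j))"
  have "sensitive_at (?M j) (?M n) (i, j)" if "j < n" for j
    using that assms col_choicesD[OF assms(1)]
    by (intro sensitive_at_row_unit_mat[of n \<tau> 0 1]) auto
  then have "4 * p - 3 \<le> query_prob (?M j) (i, j') + query_prob (?M j') (i, j)"
    if "j < n" "j' < n" for j j'
    using that by (intro query_prob_perturb_add_ge[where B = "?M n"]) auto
  then show ?thesis
    using sum_sum_ge_if_swap_ge[of "{..<n}" "4 * p - 3" "\<lambda>j j'. query_prob (?M j) (i, j')"]
    by simp
qed

lemma sum_query_prob_col_choices_ge:
  assumes "i \<in> {2..<n}"
  shows "real (card (col_choices n)) * ((4 * p - 3) / 2 * real n) \<le>
    (\<Sum>\<tau>\<in>col_choices n. \<Sum>j<n. query_prob (row_unit_mat n \<tau>) (i, j))" (is "?b \<le> ?s")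
proof -
  have "real n * ?b = (\<Sum>\<tau>\<in>col_choices n. (real n)\<^sup>2 * (4 * p - 3) / 2)"
    by (simp add: power2_eq_square)
  also have "\<dots> \<le>
      (\<Sum>\<tau>\<in>col_choices n. \<Sum>j<n. \<Sum>j'<n. query_prob (row_unit_mat n (\<tau>(i := j))) (i, j'))"
    using sum_query_prob_resampled_row_ge assms by (intro sum_mono) (simp add: field_simps)
  also have "\<dots> = real n * ?s"
    using assms sum_PiE_resample[of i "{..<n}" _ "allowed_cols n"]
    by (simp add: col_choices_def allowed_cols_def[of n i])
  finally show ?thesis
    using assms by simp
qed

lemma exists_expected_queries_ge:
  assumes "2 \<le> n"
  shows "\<exists>A \<in> carrier_mat n n. (4 * p - 3) / 2 * real n * (real n - 2) \<le> expected_queries R A"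
proof (rule ccontr)
  let ?T = "col_choices n" and ?b = "(4 * p - 3) / 2 * real n"
  assume "\<not> ?thesis"
  then have small: "expected_queries R (row_unit_mat n \<tau>) < ?b * (real n - 2)" for \<tau>
    by (meson not_le row_unit_mat_carrier)
  have "real (card ?T) * (?b * (real n - 2)) = (\<Sum>i=2..<n. real (card ?T) * ?b)"
    using assms by (simp add: of_nat_diff)
  also have "\<dots> \<le> (\<Sum>i=2..<n. \<Sum>\<tau>\<in>?T. \<Sum>j<n. query_prob (row_unit_mat n \<tau>) (i, j))"
    by (intro sum_mono sum_query_prob_col_choices_ge)
  also have "\<dots> \<le> (\<Sum>i<n. \<Sum>\<tau>\<in>?T. \<Sum>j<n. query_prob (row_unit_mat n \<tau>) (i, j))"
    by (intro sum_mono2) (auto intro!: sum_nonneg query_prob_nonneg)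
  also have "\<dots> = (\<Sum>\<tau>\<in>?T. \<Sum>i<n. \<Sum>j<n. query_prob (row_unit_mat n \<tau>) (i, j))"
    by (rule sum.swap)
  also have "\<dots> = (\<Sum>\<tau>\<in>?T. expected_queries R (row_unit_mat n \<tau>))"
    by (simp add: expected_queries_eq_sum sum.cartesian_product)
  also have "\<dots> < real (card ?T) * (?b * (real n - 2))"
    using small finite_col_choices col_choices_nonempty[OF assms]
    by (intro sum_bounded_above_strict) (auto simp: card_gt_0_iff)
  finally show False
    by simp
qed

end

theorem theorem15:
  "\<exists>c::real. c > 0 \<and>
     (\<forall>\<^sub>F n in sequentially.
        \<forall>R. randomized_alg n R \<and> decides_saddlepoint n (5 / 6) R \<longrightarrow>
          (\<exists>A \<in> carrier_mat n n. expected_queries R A \<ge> c * (real n)\<^sup>2))"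
proof (intro exI[of _ "1 / 12"] conjI eventually_sequentiallyI[of 4] allI impI)
  fix n :: nat and R
  assume n: "4 \<le> n" and R: "randomized_alg n R \<and> decides_saddlepoint n (5 / 6) R"
  interpret randomized_decider n R "5 / 6"
    using R by unfold_locales auto
  obtain A where A: "A \<in> carrier_mat n n"
    "(4 * (5 / 6) - 3) / 2 * real n * (real n - 2) \<le> expected_queries R A"
    using exists_expected_queries_ge n by auto
  have "1 / 12 * (real n)\<^sup>2 = 1 / 6 * real n * (real n / 2)"
    by (simp add: power2_eq_square)
  also have "\<dots> \<le> 1 / 6 * real n * (real n - 2)"
    using n by (intro mult_left_mono) auto
  also have "\<dots> \<le> expected_queries R A"
    using A(2) by simp
  finally show "\<exists>A \<in> carrier_mat n n. expected_queries R A \<ge> 1 / 12 * (real n)\<^sup>2"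
    using A(1) by blast
qed simp

end
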